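(* Let $n,k$ be integers with $n\ge 1$ and $k\ge 2$. For $s\ge 0$ let $\mathcal{P}(n,k,s)$ be the number of words of length $s$ over the alphabet $\{1,2,\ldots,n\}$ that contain no soft streak of length $k$, and let $f(z)=\sum_{s=0}^\infty \mathcal{P}(n,k,s)z^s$. Then $$f(z)=\frac{(1-z^k)^n}{\displaystyle\sum_{r=0}^{(k-1)n}\psi_{k,r}\,\mathcal{B}(n,k,r)\,z^r}=\frac{k}{\displaystyle\sum_{s=1}^{k-1}\left(1-\omega_k^{-s}\right)\left(1-\omega_k^{s}z\right)^{-n}},$$ as an identity of formal power series in $z$ with complex coefficients.
   Context: A word of length $s$ over $\{1,\ldots,n\}$ is a tuple $(a_1,\ldots,a_s)$ with entries in $\{1,\ldots,n\}$ (there is exactly one word of length $0$, the empty word). A subword is a contiguous block $(a_i,a_{i+1},\ldots,a_j)$. A soft streak of length $k$ in a word is a non-decreasing (weakly increasing) subword of length $k$. $\omega_k=e^{2\pi i/k}$. For $r\in\mathbb{Z}$, $\psi_{k,r}=1$ if $r\equiv 0\pmod k$, $\psi_{k,r}=-1$ if $r\equiv 1\pmod k$, and $\psi_{k,r}=0$ otherwise. $\mathcal{B}(n,k,r)$ is the coefficient of $x^r$ in the expansion of $(1+x+x^2+\cdots+x^{k-1})^n$. *)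

theory Defs
  imports
    Complex_Main
    "HOL-Library.Sublist"
    "HOL-Number_Theory.Cong"
    "HOL-Computational_Algebra.Polynomial"
    "HOL-Computational_Algebra.Formal_Power_Series"
begin

definition words :: "nat \<Rightarrow> nat \<Rightarrow> nat list set" where
  "words n s = {w. length w = s \<and> set w \<subseteq> {1..n}}"

text \<open>Subwords are contiguous, so they are rendered by \<^const>\<open>sublist\<close>
  (and not by the subsequence relation \<^const>\<open>subseq\<close>).\<close>

definition is_soft_streak :: "nat \<Rightarrow> nat list \<Rightarrow> nat list \<Rightarrow> bool" where
  "is_soft_streak k u w \<longleftrightarrow> sublist u w \<and> length u = k \<and> sorted u"

definition num_streak_free :: "nat \<Rightarrow> nat \<Rightarrow> nat \<Rightarrow> nat" where
  "num_streak_free n k s = card {w \<in> words n s. \<not> (\<exists>u. is_soft_streak k u w)}"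

definition streak_free_gf :: "nat \<Rightarrow> nat \<Rightarrow> complex fps" where
  "streak_free_gf n k = Abs_fps (\<lambda>s. of_nat (num_streak_free n k s))"

definition omega :: "nat \<Rightarrow> complex" where
  "omega k = exp (2 * of_real pi * \<i> / of_nat k)"

definition psi :: "nat \<Rightarrow> int \<Rightarrow> int" where
  "psi k r = (if [r = 0] (mod int k) then 1 else if [r = 1] (mod int k) then -1 else 0)"

definition poly_coeff :: "nat \<Rightarrow> nat \<Rightarrow> nat \<Rightarrow> int" where
  "poly_coeff n k r = coeff ((\<Sum>i<k. monom 1 i) ^ n) r"

end

theory Submission
  imports Defs
begin

text \<open>Let \<open>h\<^sub>j\<close> count the weakly increasing words of length \<open>j\<close> and put
  \<open>H = \<Sum>j. \<psi>\<^sub>k\<^sub>,\<^sub>j h\<^sub>j z\<^sup>j\<close>.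
  Everything reduces to \<open>f \<cdot> H = 1\<close>. The coefficient of \<open>z\<^sup>s\<close> in \<open>f \<cdot> H\<close> is a sum over words \<open>w\<close>
  of length \<open>s\<close>, where \<open>w\<close> contributes the sum of \<open>\<psi>\<^sub>k\<^sub>,\<^sub>j\<close> over all cuts \<open>j\<close> such that the prefix of
  length \<open>j\<close> is weakly increasing and the remaining suffix has no soft streak of length \<open>k\<close>. These
  cuts form an interval which is empty, or of the form \<open>{0..m}\<close> with \<open>1 \<le> m < k\<close>, or of length
  exactly \<open>k\<close>; in each case the sum vanishes.
  As \<open>\<Sum>j. h\<^sub>j z\<^sup>j = (1 - z)\<^sup>-\<^sup>n\<close> and \<open>\<psi>\<close> is \<open>k\<close>-periodic, the first denominator is
  \<open>(1 - z\<^sup>k)\<^sup>n H\<close>; expanding \<open>\<psi>\<close> in \<open>k\<close>-th roots of unity shows that the second one is \<open>k H\<close>.\<close>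

section \<open>Cutting a word\<close>

abbreviation streak_free :: "nat \<Rightarrow> nat list \<Rightarrow> bool" where
  "streak_free k w \<equiv> \<not> (\<exists>u. is_soft_streak k u w)"

lemma not_streak_free_iff:
  "(\<exists>u. is_soft_streak k u w) \<longleftrightarrow> (\<exists>i. i + k \<le> length w \<and> sorted (take k (drop i w)))"
proof
  assume "\<exists>u. is_soft_streak k u w"
  then obtain u ps ss where "w = ps @ u @ ss" "length u = k" "sorted u"
    by (auto simp: is_soft_streak_def sublist_def)
  then have "length ps + k \<le> length w \<and> sorted (take k (drop (length ps) w))" by simp
  then show "\<exists>i. i + k \<le> length w \<and> sorted (take k (drop i w))" by blast
next
  assume "\<exists>i. i + k \<le> length w \<and> sorted (take k (drop i w))"
  then obtain i where i: "i + k \<le> length w" "sorted (take k (drop i w))" by blast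
  have "sublist (take k (drop i w)) w"
    by (meson sublist_drop sublist_order.order.trans sublist_take)
  with i have "is_soft_streak k (take k (drop i w)) w"
    by (simp add: is_soft_streak_def)
  then show "\<exists>u. is_soft_streak k u w" by blast
qed

text \<open>Makes the cuts with a streak-free suffix upward closed; \<open>sorted_take_mono\<close>
  makes those with a sorted prefix downward closed.\<close>

lemma streak_free_drop_mono:
  assumes "streak_free k (drop i w)" "i \<le> j"
  shows "streak_free k (drop j w)"
proof -
  have "drop j w = drop (j - i) (drop i w)" using assms(2) by simp
  then have "sublist (drop j w) (drop i w)" by (metis sublist_drop)
  then show ?thesis
    using assms(1) unfolding is_soft_streak_def by (blast intro: sublist_order.order.trans)
qed

lemma sorted_take_mono: "sorted (take j w) \<Longrightarrow> i \<le> j \<Longrightarrow> sorted (take i w)"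
  by (metis min.absorb1 sorted_wrt_take take_take)

text \<open>Comparing only adjacent letters lets two overlapping sorted windows be glued
  together.\<close>

lemma sorted_window_iff:
  fixes w :: "nat list"
  assumes "i + k \<le> length w"
  shows "sorted (take k (drop i w)) \<longleftrightarrow> (\<forall>j. i \<le> j \<longrightarrow> Suc j < i + k \<longrightarrow> w ! j \<le> w ! Suc j)"
proof -
  have "sorted (take k (drop i w)) \<longleftrightarrow> (\<forall>j. Suc j < k \<longrightarrow> w ! (i + j) \<le> w ! Suc (i + j))"
    using assms by (auto simp: sorted_iff_nth_Suc)
  also have "\<dots> \<longleftrightarrow> (\<forall>j. i \<le> j \<longrightarrow> Suc j < i + k \<longrightarrow> w ! j \<le> w ! Suc j)"
  proof (intro iffI allI impI)
    fix j assume *: "\<forall>j. Suc j < k \<longrightarrow> w ! (i + j) \<le> w ! Suc (i + j)" "i \<le> j" "Suc j < i + k"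
    show "w ! j \<le> w ! Suc j" using *(1)[rule_format, of "j - i"] *(2,3) by simp
  qed simp
  finally show ?thesis .
qed

section \<open>Sums of \<open>psi\<close> over intervals of cuts\<close>

lemma psi_periodic: "psi k (int (j + k)) = psi k (int j)"
  by (simp add: psi_def cong_def)

lemma psi_0: "psi k 0 = 1"
  by (simp add: psi_def)

lemma psi_1: "k \<ge> 2 \<Longrightarrow> psi k 1 = -1"
  by (auto simp: psi_def cong_def)

lemma psi_eq_0: "2 \<le> j \<Longrightarrow> j < k \<Longrightarrow> psi k (int j) = 0"
  by (auto simp: psi_def cong_def)

text \<open>Below \<open>k\<close> only the indices 0 and 1 contribute, and they cancel.\<close>

lemma sum_psi_initial:
  assumes "1 \<le> m" "m < k"
  shows "(\<Sum>j\<in>{0..m}. psi k (int j)) = 0"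
  using assms
proof (induction m rule: nat_induct_at_least)
  case base
  then show ?case by (simp add: psi_0 psi_1)
next
  case (Suc m)
  then show ?case using psi_eq_0[of "Suc m" k] by simp
qed

text \<open>Sliding the window by one exchanges \<open>psi k t\<close> for
  \<open>psi k (t + k)\<close>, which are equal; the window at 0 is an initial sum.\<close>

lemma sum_psi_period:
  assumes "k \<ge> 2"
  shows "(\<Sum>j\<in>{t..<t + k}. psi k (int j)) = 0"
proof (induction t)
  case 0
  have "{0..<0 + k} = {0..k - 1}" using assms by auto
  then show ?case using sum_psi_initial[of "k - 1" k] assms by (simp only:)
next
  case (Suc t)
  have "(\<Sum>j\<in>{t..<t + k}. psi k (int j)) + psi k (int (t + k))
      = psi k (int t) + (\<Sum>j\<in>{Suc t..<Suc t + k}. psi k (int j))"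
    using assms by (subst sum.atLeast_Suc_lessThan[symmetric]) auto
  then show ?case using Suc psi_periodic[of k t] by simp
qed

lemma sum_psi_cuts:
  fixes w :: "nat list"
  assumes k: "k \<ge> 2" and w: "w \<noteq> []"
  shows "(\<Sum>j\<in>{j. j \<le> length w \<and> sorted (take j w) \<and> streak_free k (drop j w)}. psi k (int j)) = 0"
    (is "sum _ ?J = 0")
proof -
  define t where "t = (LEAST j. streak_free k (drop j w))"
  define m where "m = (GREATEST j. j \<le> length w \<and> sorted (take j w))"
  \<comment> \<open>The empty suffix is streak-free as \<open>k > 0\<close>, so the least cut
    \<open>t\<close> exists.\<close>
  have "streak_free k (drop (length w) w)" using k by (auto simp: is_soft_streak_def)
  then have t_free: "streak_free k (drop t w)" unfolding t_def by (rule LeastI)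
  have free_iff: "streak_free k (drop j w) \<longleftrightarrow> t \<le> j" for j
    using t_free streak_free_drop_mono[of k t w j] Least_le[of "\<lambda>j. streak_free k (drop j w)" j]
    unfolding t_def by blast
  have m: "m \<le> length w \<and> sorted (take m w)"
    unfolding m_def by (rule GreatestI_nat[of _ 0 "length w"]) auto
  have m_max: "j \<le> m" if "j \<le> length w" "sorted (take j w)" for j
    unfolding m_def using that by (intro Greatest_le_nat[of _ j "length w"]) auto
  have J: "?J = {t..m}"
  proof (rule set_eqI)
    fix j
    have "j \<le> length w \<and> sorted (take j w) \<longleftrightarrow> j \<le> m"
      using m m_max sorted_take_mono le_trans by blast
    then show "j \<in> ?J \<longleftrightarrow> j \<in> {t..m}" unfolding free_iff by auto
  qed
  have "length w \<ge> 1" using w by (cases w) auto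
  then have m1: "1 \<le> m" by (intro m_max) (auto simp: sorted_iff_nth_Suc)
  \<comment> \<open>Otherwise the window of length \<open>k\<close> starting at \<open>t\<close>
    lies in the sorted prefix and is a streak in the suffix at \<open>t\<close>.\<close>
  have m_upper: "m < t + k"
  proof (rule ccontr)
    assume "\<not> m < t + k"
    then have le: "t + k \<le> m" by simp
    then have "sorted (take (t + k) w)" using m sorted_take_mono by blast
    then have "sorted (take k (drop t w))"
      using sorted_wrt_drop[of "(\<le>)" "take (t + k) w" t] by (simp add: drop_take)
    then show False using t_free le m unfolding not_streak_free_iff
      by (auto dest!: spec[of _ 0])
  qed
  consider "t = 0" | "t > m" | "0 < t" "t \<le> m" by linarith
  then show ?thesis
  proof cases
    case 1
    then show ?thesis unfolding J using m1 m_upper sum_psi_initial by simp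
  next
    case 2
    then show ?thesis unfolding J by simp
  next
    case 3
    have "\<not> streak_free k (drop (t - 1) w)" using free_iff 3 by simp
    then obtain i where i: "i + k \<le> length (drop (t - 1) w)"
        "sorted (take k (drop i (drop (t - 1) w)))"
      using not_streak_free_iff by blast
    \<comment> \<open>By minimality of \<open>t\<close> the suffix at \<open>t - 1\<close> has a
      streak; it must start at \<open>t - 1\<close>, since a later one would lie in the suffix at
      \<open>t\<close>.\<close>
    have "i = 0"
    proof (rule ccontr)
      assume "i \<noteq> 0"
      then have "drop i (drop (t - 1) w) = drop (i - 1) (drop t w)" using 3 by simp
      moreover have "(i - 1) + k \<le> length (drop t w)" using i(1) \<open>i \<noteq> 0\<close> 3 k by simp
      ultimately show False using i(2) t_free not_streak_free_iff[of k "drop t w"] by metis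
    qed
    then have len: "t - 1 + k \<le> length w" and st: "sorted (take k (drop (t - 1) w))"
      using i k by auto
    \<comment> \<open>Glue the sorted prefix of length \<open>m\<close> to the streak starting at
      \<open>t - 1\<close>. As \<open>t \<le> m\<close> they share a letter, so each adjacent pair
      lies in one of them. Maximality of \<open>m\<close> then forces
      \<open>m = t + k - 1\<close>.\<close>
    have "sorted (take (t - 1 + k) (drop 0 w))"
    proof (subst sorted_window_iff)
      show "\<forall>j. 0 \<le> j \<longrightarrow> Suc j < 0 + (t - 1 + k) \<longrightarrow> w ! j \<le> w ! Suc j"
      proof (intro allI impI)
        fix j assume j: "Suc j < 0 + (t - 1 + k)"
        show "w ! j \<le> w ! Suc j"
        proof (cases "Suc j < m")
          case True
          then show ?thesis using m sorted_window_iff[of 0 m w] by simp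
        next
          case False
          then have "t - 1 \<le> j" using 3 by simp
          then show ?thesis using st sorted_window_iff[OF len] j by simp
        qed
      qed
    qed (use len in simp)
    then have "t - 1 + k \<le> m" using m_max len by simp
    then have "{t..m} = {t..<t + k}" using m_upper 3 by auto
    then show ?thesis unfolding J using sum_psi_period[OF k] by simp
  qed
qed

section \<open>Double counting of words with a marked cut\<close>

lemma finite_words: "finite (words n s)"
proof -
  have "words n s = {w. set w \<subseteq> {1..n} \<and> length w = s}" by (auto simp: words_def)
  then show ?thesis by (simp add: finite_lists_length_eq)
qed

definition num_sorted :: "nat \<Rightarrow> nat \<Rightarrow> nat" where
  "num_sorted n j = card {w \<in> words n j. sorted w}"

lemma card_cut_words:
  assumes "j \<le> s"
  shows "card {w \<in> words n s. sorted (take j w) \<and> streak_free k (drop j w)}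
       = num_sorted n j * num_streak_free n k (s - j)"
proof -
  let ?A = "{w \<in> words n j. sorted w}" and ?B = "{w \<in> words n (s - j). streak_free k w}"
  have "bij_betw (\<lambda>(u, v). u @ v) (?A \<times> ?B)
      {w \<in> words n s. sorted (take j w) \<and> streak_free k (drop j w)}"
    by (rule bij_betw_byWitness[where f' = "\<lambda>w. (take j w, drop j w)"])
      (use assms in \<open>auto simp: words_def simp del: atLeastAtMost_iff dest: in_set_takeD in_set_dropD\<close>)
  from bij_betw_same_card[OF this] show ?thesis
    unfolding card_cartesian_product num_sorted_def num_streak_free_def by (rule sym)
qed

text \<open>Interchange the sums over cuts and words: each word contributes its \<open>psi\<close>
  sum over admissible cuts. The condition \<open>s \<ge> 1\<close> keeps the words nonempty.\<close>

lemma sum_psi_streak_free: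
  assumes k: "k \<ge> 2" and s: "s \<ge> 1"
  shows "(\<Sum>j\<le>s. psi k (int j) * int (num_sorted n j * num_streak_free n k (s - j))) = 0"
proof -
  let ?P = "\<lambda>j w. sorted (take j w) \<and> streak_free k (drop j w)"
  have "(\<Sum>j\<le>s. psi k (int j) * int (num_sorted n j * num_streak_free n k (s - j)))
      = (\<Sum>j\<le>s. \<Sum>w\<in>words n s. if ?P j w then psi k (int j) else 0)"
  proof (rule sum.cong)
    fix j assume "j \<in> {..s}"
    then have "psi k (int j) * int (num_sorted n j * num_streak_free n k (s - j))
        = psi k (int j) * int (card {w \<in> words n s. ?P j w})"
      using card_cut_words[of j s n k] by simp
    also have "\<dots> = (\<Sum>w\<in>{w \<in> words n s. ?P j w}. psi k (int j))" by simp
    also have "\<dots> = (\<Sum>w\<in>words n s. if ?P j w then psi k (int j) else 0)"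
      by (rule sum.inter_filter[OF finite_words])
    finally show "psi k (int j) * int (num_sorted n j * num_streak_free n k (s - j)) = \<dots>" .
  qed simp
  also have "\<dots> = (\<Sum>w\<in>words n s. \<Sum>j\<le>s. if ?P j w then psi k (int j) else 0)"
    by (rule sum.swap)
  also have "\<dots> = 0"
  proof (rule sum.neutral, rule ballI)
    fix w assume "w \<in> words n s"
    then have l: "length w = s" by (simp add: words_def)
    have "(\<Sum>j\<le>s. if ?P j w then psi k (int j) else 0) = (\<Sum>j\<in>{j \<in> {..s}. ?P j w}. psi k (int j))"
      by (rule sum.inter_filter[symmetric]) simp
    also have "{j \<in> {..s}. ?P j w} = {j. j \<le> length w \<and> ?P j w}" using l by auto
    also have "(\<Sum>j\<in>\<dots>. psi k (int j)) = 0" using l s by (intro sum_psi_cuts[OF k]) auto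
    finally show "(\<Sum>j\<le>s. if ?P j w then psi k (int j) else 0) = 0" .
  qed
  finally show ?thesis .
qed

section \<open>Generating functions\<close>

lemma num_sorted_0_right: "num_sorted n 0 = 1"
proof -
  have "{w \<in> words n 0. sorted w} = {[]}" by (auto simp: words_def)
  then show ?thesis by (simp add: num_sorted_def)
qed

lemma num_sorted_0_Suc: "num_sorted 0 (Suc j) = 0"
  by (auto simp: num_sorted_def words_def)

text \<open>The last letter of a sorted word is its maximum: if it is \<open>Suc n\<close>, remove
  it; otherwise \<open>Suc n\<close> does not occur at all.\<close>

lemma num_sorted_Suc_Suc:
  "num_sorted (Suc n) (Suc j) = num_sorted (Suc n) j + num_sorted n (Suc j)"
proof -
  let ?A = "{w \<in> words (Suc n) j. sorted w}" and ?B = "{w \<in> words n (Suc j). sorted w}"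
  let ?f = "\<lambda>w. w @ [Suc n]"
  have "{w \<in> words (Suc n) (Suc j). sorted w} = ?f ` ?A \<union> ?B"
  proof (intro equalityI subsetI)
    fix w assume w: "w \<in> {w \<in> words (Suc n) (Suc j). sorted w}"
    then have "w \<noteq> []" by (auto simp: words_def)
    then obtain v a where v: "w = v @ [a]" by (metis rev_exhaust)
    show "w \<in> ?f ` ?A \<union> ?B"
    proof (cases "a = Suc n")
      case True
      then show ?thesis using w v by (auto simp: words_def sorted_append)
    next
      case False
      have "set w \<subseteq> {1..n}"
      proof
        fix x assume x: "x \<in> set w"
        have "a \<le> n" using False w v by (auto simp: words_def)
        moreover have "x \<le> a" using w v x by (auto simp: sorted_append)
        moreover have "1 \<le> x" using w x by (auto simp: words_def)
        ultimately show "x \<in> {1..n}" by simp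
      qed
      then show ?thesis using w by (auto simp: words_def)
    qed
  next
    fix w assume "w \<in> ?f ` ?A \<union> ?B"
    then show "w \<in> {w \<in> words (Suc n) (Suc j). sorted w}"
      by (fastforce simp: words_def sorted_append)
  qed
  moreover have "?f ` ?A \<inter> ?B = {}" by (auto simp: words_def)
  moreover have "card (?f ` ?A) = card ?A" by (rule card_image) (auto simp: inj_on_def)
  ultimately show ?thesis
    unfolding num_sorted_def by (simp add: card_Un_disjoint finite_words)
qed

text \<open>By the recurrence, each factor \<open>1 - c z\<close> lowers the alphabet size by one.
  The first denominator uses \<open>c = 1\<close>, the second the powers of
  \<open>omega k\<close>.\<close>

lemma num_sorted_gf:
  fixes c :: "'a :: comm_ring_1"
  shows "(1 - fps_const c * fps_X) ^ n * Abs_fps (\<lambda>j. c ^ j * of_nat (num_sorted n j)) = 1"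
proof (induction n)
  case 0
  show ?case
  proof (rule fps_ext)
    fix i show "fps_nth ((1 - fps_const c * fps_X) ^ 0 * Abs_fps (\<lambda>j. c ^ j * of_nat (num_sorted 0 j))) i
      = fps_nth 1 i"
      by (cases i) (simp_all add: num_sorted_0_right num_sorted_0_Suc)
  qed
next
  case (Suc n)
  have "(1 - fps_const c * fps_X) * Abs_fps (\<lambda>j. c ^ j * of_nat (num_sorted (Suc n) j))
      = Abs_fps (\<lambda>j. c ^ j * of_nat (num_sorted n j))" (is "?l = ?r")
  proof (rule fps_ext)
    fix i show "fps_nth ?l i = fps_nth ?r i"
      by (cases i) (simp_all add: num_sorted_0_right num_sorted_Suc_Suc left_diff_distrib
          mult.assoc algebra_simps)
  qed
  then show ?case using Suc by (simp add: power_Suc2 mult.assoc del: power_Suc)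
qed

section \<open>The Hadamard product with \<open>psi\<close> and the relation
  \<open>f H = 1\<close>\<close>

definition psi_fps :: "nat \<Rightarrow> complex fps \<Rightarrow> complex fps" where
  "psi_fps k F = Abs_fps (\<lambda>j. of_int (psi k (int j)) * fps_nth F j)"

text \<open>Multiplication by \<open>z^k\<close> shifts indices by a period of \<open>psi\<close>,
  so it commutes with the Hadamard product.\<close>

lemma psi_fps_mult_periodic: "psi_fps k ((1 - fps_X ^ k) ^ n * F) = (1 - fps_X ^ k) ^ n * psi_fps k F"
proof (induction n)
  case (Suc n)
  have step: "psi_fps k ((1 - fps_X ^ k) * G) = (1 - fps_X ^ k) * psi_fps k G" for G
  proof (rule fps_ext)
    fix i
    have "psi k (int (i - k)) = psi k (int i)" if "k \<le> i"
      using psi_periodic[of k "i - k"] that by simp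
    then show "fps_nth (psi_fps k ((1 - fps_X ^ k) * G)) i
        = fps_nth ((1 - fps_X ^ k) * psi_fps k G) i"
      by (simp add: psi_fps_def left_diff_distrib fps_X_power_mult_nth right_diff_distrib)
  qed
  show ?case using step Suc by (simp add: mult.assoc)
qed simp

definition sorted_fps :: "nat \<Rightarrow> complex fps" where
  "sorted_fps n = Abs_fps (\<lambda>j. of_nat (num_sorted n j))"

lemma streak_free_gf_mult:
  assumes "k \<ge> 2"
  shows "psi_fps k (sorted_fps n) * streak_free_gf n k = 1"
proof (rule fps_ext)
  fix s
  show "fps_nth (psi_fps k (sorted_fps n) * streak_free_gf n k) s = fps_nth 1 s"
  proof (cases s)
    case 0
    \<comment> \<open>The constant term comes from the empty word, whose only cut has weight
      \<open>psi k 0 = 1\<close>.\<close>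
    have "{w \<in> words n 0. streak_free k w} = {[]}"
      using assms by (auto simp: words_def is_soft_streak_def)
    then have "num_streak_free n k 0 = 1" by (simp add: num_streak_free_def)
    then show ?thesis
      using 0 by (simp add: psi_fps_def sorted_fps_def streak_free_gf_def num_sorted_0_right psi_0)
  next
    case (Suc m)
    have "fps_nth (psi_fps k (sorted_fps n) * streak_free_gf n k) s
        = of_int (\<Sum>j\<le>s. psi k (int j) * int (num_sorted n j * num_streak_free n k (s - j)))"
      by (simp add: psi_fps_def sorted_fps_def streak_free_gf_def fps_mult_nth atMost_atLeast0 mult.assoc)
    also have "\<dots> = 0" using Suc assms by (subst sum_psi_streak_free) auto
    finally show ?thesis using Suc by simp
  qed
qed

lemma psi_sorted_nth_0: "fps_nth (psi_fps k (sorted_fps n)) 0 = 1"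
  by (simp add: psi_fps_def sorted_fps_def num_sorted_0_right psi_0)

section \<open>The two denominators\<close>

lemma coeff_power_of_int:
  fixes p :: "int poly"
  shows "Abs_fps (\<lambda>r. of_int (coeff (p ^ n) r)) = (Abs_fps (\<lambda>r. of_int (coeff p r)) :: 'a :: comm_ring_1 fps) ^ n"
proof (induction n)
  case 0
  show ?case by (rule fps_ext) (simp add: coeff_eq_0 Polynomial.coeff_1)
next
  case (Suc n)
  have "Abs_fps (\<lambda>r. of_int (coeff (p ^ Suc n) r))
      = Abs_fps (\<lambda>r. of_int (coeff p r)) * (Abs_fps (\<lambda>r. of_int (coeff (p ^ n) r)) :: 'a fps)"
    by (rule fps_ext) (simp add: coeff_mult fps_mult_nth atMost_atLeast0)
  then show ?case using Suc by simp
qed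

text \<open>The \<open>n\<close>-th power of the finite geometric sum identity.\<close>

lemma poly_coeff_fps:
  "(1 - fps_X) ^ n * Abs_fps (\<lambda>r. of_int (poly_coeff n k r)) = (1 - fps_X ^ k :: complex fps) ^ n"
proof -
  have "Abs_fps (\<lambda>r. of_int (coeff (\<Sum>i<k. monom 1 i) r)) = (\<Sum>i<k. fps_X ^ i :: complex fps)"
  proof (rule fps_ext)
    fix r
    have "(\<Sum>i<k. if i = r then 1 else 0 :: complex) = (\<Sum>i<k. if r = i then 1 else 0)"
      by (intro sum.cong) auto
    then show "fps_nth (Abs_fps (\<lambda>r. of_int (coeff (\<Sum>i<k. monom 1 i) r))) r
        = fps_nth (\<Sum>i<k. fps_X ^ i :: complex fps) r"
      by (simp add: fps_sum_nth Polynomial.coeff_sum)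
  qed
  then have "Abs_fps (\<lambda>r. of_int (poly_coeff n k r)) = (\<Sum>i<k. fps_X ^ i :: complex fps) ^ n"
    by (simp add: poly_coeff_def coeff_power_of_int)
  then show ?thesis
    by (simp add: one_diff_power_eq power_mult_distrib)
qed

lemma poly_coeff_eq_0:
  assumes "r > (k - 1) * n"
  shows "poly_coeff n k r = 0"
proof -
  have "degree (\<Sum>i<k. monom (1 :: int) i) \<le> k - 1"
    by (intro degree_sum_le) (auto simp: degree_monom_eq)
  then have "degree ((\<Sum>i<k. monom (1 :: int) i) ^ n) \<le> (k - 1) * n"
    by (meson degree_power_le le_trans mult_le_mono1)
  then show ?thesis using assms unfolding poly_coeff_def by (intro coeff_eq_0) simp
qed

lemma first_denominator:
  "(\<Sum>r=0..(k - 1) * n. fps_const (of_int (psi k (int r) * poly_coeff n k r)) * fps_X ^ r)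
     = (1 - fps_X ^ k) ^ n * psi_fps k (sorted_fps n)"
proof -
  have "(\<Sum>r=0..(k - 1) * n. fps_const (of_int (psi k (int r) * poly_coeff n k r)) * fps_X ^ r)
      = psi_fps k (Abs_fps (\<lambda>r. of_int (poly_coeff n k r)))" (is "?l = ?r")
  proof (rule fps_ext)
    fix i
    \<comment> \<open>Above degree \<open>(k - 1) * n\<close> the coefficients vanish, so the
      truncated sum is the whole series.\<close>
    show "fps_nth ?l i = fps_nth ?r i"
      using poly_coeff_eq_0[of k n i]
      by (simp add: psi_fps_def fps_sum_nth if_distrib[of "(*) _"] cong: if_cong)
  qed
  moreover have "Abs_fps (\<lambda>r. of_int (poly_coeff n k r)) = (1 - fps_X ^ k) ^ n * sorted_fps n"
  proof -
    have h: "(1 - fps_X) ^ n * sorted_fps n = 1"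
      using num_sorted_gf[of "1 :: complex" n] by (simp add: sorted_fps_def)
    let ?F = "Abs_fps (\<lambda>r. of_int (poly_coeff n k r)) :: complex fps"
    have "?F = ((1 - fps_X) ^ n * sorted_fps n) * ?F" using h by simp
    also have "\<dots> = ((1 - fps_X) ^ n * ?F) * sorted_fps n" by (simp add: mult_ac)
    finally show ?thesis by (simp add: poly_coeff_fps)
  qed
  ultimately show ?thesis by (simp add: psi_fps_mult_periodic)
qed

section \<open>Roots of unity and the second denominator\<close>

lemma omega_cis: "omega k = cis (2 * pi / real k)"
  by (simp add: omega_def cis_conv_exp mult_ac)

lemma omega_pow_k: "k > 0 \<Longrightarrow> omega k ^ k = 1"
  by (simp add: omega_cis Complex.DeMoivre)

lemma omega_pow_eq_1_iff:
  assumes "k > 0"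
  shows "omega k ^ j = 1 \<longleftrightarrow> k dvd j"
proof
  assume a: "omega k ^ j = 1"
  have "omega k ^ (j mod k) = 1"
  proof -
    have "omega k ^ j = omega k ^ (j mod k + k * (j div k))" by simp
    also have "\<dots> = omega k ^ (j mod k)"
      unfolding power_add power_mult omega_pow_k[OF assms] by simp
    finally show ?thesis using a by simp
  qed
  then have "cis (2 * pi * real (j mod k) / real k) = cis (2 * pi * real 0 / real k)"
    by (simp add: omega_cis Complex.DeMoivre mult_ac)
  moreover have "inj_on (\<lambda>i. cis (2 * pi * real i / real k)) {..<k}"
    using bij_betw_roots_unity[OF assms] by (rule bij_betw_imp_inj_on)
  ultimately have "j mod k = 0" using assms by (auto dest: inj_onD[of _ _ "j mod k" 0])
  then show "k dvd j" by auto
next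
  assume "k dvd j"
  then show "omega k ^ j = 1" using omega_pow_k[OF assms] by (auto simp: power_mult)
qed

text \<open>A geometric sum of ratio \<open>omega k ^ j\<close>, a \<open>k\<close>-th root of unity
  that is 1 exactly when \<open>k dvd j\<close>.\<close>

lemma sum_omega_pow:
  assumes "k > 0"
  shows "(\<Sum>s<k. (omega k ^ s) ^ j) = (if k dvd j then of_nat k else 0)"
proof -
  have "(\<Sum>s<k. (omega k ^ s) ^ j) = (\<Sum>s<k. (omega k ^ j) ^ s)"
    by (simp add: power_mult[symmetric] mult.commute)
  also have "\<dots> = (if k dvd j then of_nat k else 0)"
  proof (cases "k dvd j")
    case True
    then have "omega k ^ j = 1" using omega_pow_eq_1_iff[OF assms] by blast
    then show ?thesis using True by simp
  next
    case False
    have "(omega k ^ j) ^ k = 1"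
      using omega_pow_k[OF assms] by (metis mult.commute power_mult power_one)
    then show ?thesis using False omega_pow_eq_1_iff[OF assms, of j] by (simp add: geometric_sum)
  qed
  finally show ?thesis .
qed

text \<open>The discrete Fourier expansion of \<open>psi\<close>: the two terms of the factor detect
  the residues 0 and 1.\<close>

lemma sum_omega_psi:
  assumes k: "k \<ge> 2"
  shows "(\<Sum>s=1..k - 1. (1 - omega k powi (- int s)) * (omega k ^ s) ^ j)
       = of_nat k * of_int (psi k (int j))"
proof -
  have "k > 0" using k by simp
  \<comment> \<open>Trades the negative exponent for a natural one, so that
    \<open>sum_omega_pow\<close> applies.\<close>
  have inv: "omega k powi (- int s) = (omega k ^ s) ^ (k - 1)" for s
  proof -
    have "omega k ^ s * (omega k ^ s) ^ (k - 1) = (omega k ^ s) ^ k"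
      using \<open>k > 0\<close> by (cases k) simp_all
    also have "\<dots> = (omega k ^ k) ^ s" by (simp add: power_mult[symmetric] mult.commute)
    finally have "omega k ^ s * (omega k ^ s) ^ (k - 1) = (omega k ^ k) ^ s" .
    then have "omega k ^ s * (omega k ^ s) ^ (k - 1) = 1" using omega_pow_k[OF \<open>k > 0\<close>] by simp
    then show ?thesis by (simp add: power_int_minus inverse_unique)
  qed
  have "(\<Sum>s=1..k - 1. (1 - omega k powi (- int s)) * (omega k ^ s) ^ j)
      = (\<Sum>s<k. (1 - omega k powi (- int s)) * (omega k ^ s) ^ j)"
    \<comment> \<open>The added term \<open>s = 0\<close> vanishes because
      \<open>1 - omega k powi 0 = 0\<close>.\<close>
    by (rule sum.mono_neutral_left) (use k in \<open>auto simp: Suc_le_eq\<close>)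
  also have "\<dots> = (\<Sum>s<k. (omega k ^ s) ^ j) - (\<Sum>s<k. (omega k ^ s) ^ (j + (k - 1)))"
    unfolding inv power_add by (simp add: right_diff_distrib sum_subtractf mult.commute)
  also have "\<dots> = of_nat k * of_int (psi k (int j))"
  proof -
    have "[int j = 0] (mod int k) \<longleftrightarrow> k dvd j" by (simp add: cong_0_iff)
    moreover have "[int j = 1] (mod int k) \<longleftrightarrow> k dvd j + (k - 1)"
    proof -
      have "int (j + (k - 1)) = int j - 1 + int k" using k by simp
      then have "k dvd j + (k - 1) \<longleftrightarrow> int k dvd int j - 1"
        by (metis dvd_add_left_iff dvd_refl int_dvd_int_iff)
      then show ?thesis by (simp add: cong_iff_dvd_diff)
    qed
    \<comment> \<open>For \<open>k \<ge> 2\<close> the residues 0 and 1 differ, so at most one of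
      the two sums is nonzero, matching the nested cases of \<open>psi\<close>.\<close>
    moreover have "\<not> (k dvd j \<and> k dvd j + (k - 1))"
    proof
      assume "k dvd j \<and> k dvd j + (k - 1)"
      then have "k dvd k - 1" using dvd_add_right_iff by blast
      then show False using k by (auto dest!: dvd_imp_le)
    qed
    ultimately show ?thesis using \<open>k > 0\<close> by (auto simp: sum_omega_pow psi_def)
  qed
  finally show ?thesis .
qed

text \<open>The coefficient of \<open>z^j\<close> on the left is \<open>num_sorted n j\<close> times
  the Fourier sum for \<open>psi\<close>.\<close>

lemma second_denominator:
  assumes "k \<ge> 2"
  shows "(\<Sum>s=1..k - 1. fps_const (1 - omega k powi (- int s)) *
              inverse ((1 - fps_const (omega k ^ s) * fps_X) ^ n))
       = fps_const (of_nat k) * psi_fps k (sorted_fps n)" (is "?l = ?r")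
proof (rule fps_ext)
  fix j
  have inv: "inverse ((1 - fps_const c * fps_X) ^ n) = Abs_fps (\<lambda>j. c ^ j * of_nat (num_sorted n j))"
    for c :: complex
    using num_sorted_gf[of c n] by (rule fps_inverse_unique)
  have "fps_nth ?l j = (\<Sum>s=1..k - 1. (1 - omega k powi (- int s)) * (omega k ^ s) ^ j)
      * of_nat (num_sorted n j)"
    unfolding inv fps_sum_nth sum_distrib_right by (intro sum.cong) simp_all
  then show "fps_nth ?l j = fps_nth ?r j"
    unfolding sum_omega_psi[OF assms] by (simp add: psi_fps_def sorted_fps_def)
qed

theorem theorem3p9:
  fixes n k :: nat
  assumes "n \<ge> 1" and "k \<ge> 2"
  shows "streak_free_gf n k =
           (1 - fps_X ^ k) ^ n /
           (\<Sum>r=0..(k - 1) * n. fps_const (of_int (psi k (int r) * poly_coeff n k r)) * fps_X ^ r)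
       \<and> (1 - fps_X ^ k) ^ n /
           (\<Sum>r=0..(k - 1) * n. fps_const (of_int (psi k (int r) * poly_coeff n k r)) * fps_X ^ r) =
         fps_const (of_nat k) /
           (\<Sum>s=1..k - 1. fps_const (1 - omega k powi (- int s)) *
              inverse ((1 - fps_const (omega k ^ s) * fps_X) ^ n))"
proof -
  let ?H = "psi_fps k (sorted_fps n)"
  have gf: "streak_free_gf n k * ?H = 1"
    using streak_free_gf_mult[OF assms(2)] by (simp add: mult.commute)
  have "?H \<noteq> 0" using psi_sorted_nth_0[of k n] by auto
  \<comment> \<open>Both quotients have this shape, with \<open>A\<close> equal to
    \<open>(1 - fps_X ^ k) ^ n\<close> and to the constant \<open>k\<close>.\<close>
  have cancel: "A / (A * ?H) = streak_free_gf n k" if "A \<noteq> 0" for A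
  proof -
    have "A * ?H \<noteq> 0" using that \<open>?H \<noteq> 0\<close> by simp
    have "A = streak_free_gf n k * (A * ?H)"
      using gf by (metis mult.left_commute mult.right_neutral)
    then show ?thesis using \<open>A * ?H \<noteq> 0\<close> by (metis nonzero_mult_div_cancel_right)
  qed
  have "(1 - fps_X ^ k :: complex fps) ^ n \<noteq> 0"
  proof
    assume "(1 - fps_X ^ k :: complex fps) ^ n = 0"
    \<comment> \<open>The constant term of this power is in fact 1, as \<open>k > 0\<close>.\<close>
    then have "fps_nth ((1 - fps_X ^ k :: complex fps) ^ n) 0 = 0" by simp
    then show False using assms(2) by (simp add: fps_power_zeroth zero_power)
  qed
  moreover have "fps_const (of_nat k :: complex) \<noteq> 0" using assms(2) by simp
  ultimately show ?thesis
    unfolding first_denominator second_denominator[OF assms(2)] by (metis cancel)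
qed

end
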